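(* Let $G$ be a connected graph with vertex set $\{1,\dots,n\}$, $n\ge 2$, let $\Phi=(F_1,\dots,F_n)$ be an $n$-tuple of pairwise disjoint graphs, and let $G[\Phi]$ be the generalized lexicographic product. If $i(F_1)=i(F_2)=\dots=i(F_n)$, then $i(G[\Phi])=i(G)\,i(F_1)$. If $\beta_0(F_1)=\beta_0(F_2)=\dots=\beta_0(F_n)$, then $\beta_0(G[\Phi])=\beta_0(G)\,\beta_0(F_1)$.
   Context: All graphs are finite, simple and undirected. The generalized lexicographic product $G[\Phi]$ is the graph with vertex set $\bigcup_{i=1}^n V(F_i)$ in which each $F_i$ is an induced subgraph, and for $x\in V(F_i)$, $y\in V(F_j)$ with $i\neq j$, $xy$ is an edge iff $ij\in E(G)$. $i(H)$ is the minimum cardinality of a maximal independent set of $H$ (independent domination number) and $\beta_0(H)$ the maximum cardinality of an independent set (independence number). *)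

theory Defs
  imports "Graph_Theory.Graph_Theory" "HOL-Library.Disjoint_Sets"
begin

text \<open>Finite simple undirected graphs are the finite, loop-free, symmetric digraphs without
  parallel arcs of the locale \<^locale>\<open>pair_graph\<close>; an edge \<open>xy\<close> is the pair of arcs
  \<open>(x, y)\<close> and \<open>(y, x)\<close>.\<close>

definition gen_lex_prod ::
    "'v pair_pre_digraph \<Rightarrow> ('v \<Rightarrow> 'a pair_pre_digraph) \<Rightarrow> 'a pair_pre_digraph" where
  "gen_lex_prod G F =
    \<lparr> pverts = (\<Union>i\<in>pverts G. pverts (F i)),
      parcs = (\<Union>i\<in>pverts G. parcs (F i)) \<union>
        {(x, y). \<exists>i\<in>pverts G. \<exists>j\<in>pverts G. i \<noteq> j \<and>
           x \<in> pverts (F i) \<and> y \<in> pverts (F j) \<and> (i, j) \<in> parcs G} \<rparr>"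

definition independent_set :: "'a pair_pre_digraph \<Rightarrow> 'a set \<Rightarrow> bool" where
  "independent_set H S \<longleftrightarrow> S \<subseteq> pverts H \<and> (\<forall>x\<in>S. \<forall>y\<in>S. (x, y) \<notin> parcs H)"

definition maximal_independent_set :: "'a pair_pre_digraph \<Rightarrow> 'a set \<Rightarrow> bool" where
  "maximal_independent_set H S \<longleftrightarrow>
    independent_set H S \<and> \<not> (\<exists>T. independent_set H T \<and> S \<subset> T)"

definition independent_domination_number :: "'a pair_pre_digraph \<Rightarrow> nat" where
  "independent_domination_number H = Min (card ` {S. maximal_independent_set H S})"

definition independence_number :: "'a pair_pre_digraph \<Rightarrow> nat" where
  "independence_number H = Max (card ` {S. independent_set H S})"

lemma pair_graphD:
  assumes "pair_graph H"
  shows "finite (pverts H)" "sym (parcs H)" "(x, y) \<in> parcs H \<Longrightarrow> x \<noteq> y"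
    "(x, y) \<in> parcs H \<Longrightarrow> x \<in> pverts H" "(x, y) \<in> parcs H \<Longrightarrow> y \<in> pverts H"
proof -
  interpret H: pair_graph H by (rule assms)
  show "finite (pverts H)" by (rule H.pair_finite_verts)
  show "sym (parcs H)" using H.pair_sym_arcs by (simp add: symmetric_def)
  show "(x, y) \<in> parcs H \<Longrightarrow> x \<noteq> y" using H.pair_no_loops[of "(x, y)"] by simp
  show "(x, y) \<in> parcs H \<Longrightarrow> x \<in> pverts H" by (rule H.in_arcsD1)
  show "(x, y) \<in> parcs H \<Longrightarrow> y \<in> pverts H" by (rule H.in_arcsD2)
qed

lemma pair_graph_gen_lex_prod:
  assumes G: "pair_graph G" and F: "\<And>i. i \<in> pverts G \<Longrightarrow> pair_graph (F i)"
    and disj: "disjoint_family_on (\<lambda>i. pverts (F i)) (pverts G)"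
  shows "pair_graph (gen_lex_prod G F)"
proof -
  let ?H = "gen_lex_prod G F"
  note FD = pair_graphD[OF F]
  have arcs: "(x, y) \<in> parcs ?H \<longleftrightarrow> (\<exists>i\<in>pverts G. (x, y) \<in> parcs (F i)) \<or>
      (\<exists>i\<in>pverts G. \<exists>j\<in>pverts G. i \<noteq> j \<and> x \<in> pverts (F i) \<and> y \<in> pverts (F j) \<and> (i, j) \<in> parcs G)"
    for x y by (simp add: gen_lex_prod_def)
  have verts: "pverts ?H = (\<Union>i\<in>pverts G. pverts (F i))"
    by (simp add: gen_lex_prod_def)
  have wf: "parcs ?H \<subseteq> pverts ?H \<times> pverts ?H"
  proof (rule subrelI)
    fix x y assume "(x, y) \<in> parcs ?H"
    then show "(x, y) \<in> pverts ?H \<times> pverts ?H"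
      unfolding arcs verts by (auto dest: FD(4,5))
  qed
  have fin: "finite (pverts ?H)"
    unfolding verts by (intro finite_UN_I pair_graphD(1)[OF G] FD(1))
  have "sym (parcs ?H)"
  proof (rule symI)
    fix x y assume "(x, y) \<in> parcs ?H"
    then show "(y, x) \<in> parcs ?H"
      unfolding arcs
    proof (elim disjE bexE conjE)
      fix i assume "i \<in> pverts G" "(x, y) \<in> parcs (F i)"
      then show "(\<exists>i\<in>pverts G. (y, x) \<in> parcs (F i)) \<or> (\<exists>i\<in>pverts G. \<exists>j\<in>pverts G.
          i \<noteq> j \<and> y \<in> pverts (F i) \<and> x \<in> pverts (F j) \<and> (i, j) \<in> parcs G)"
        by (auto dest: symD[OF FD(2)])
    next
      fix i j assume *: "i \<in> pverts G" "j \<in> pverts G" "i \<noteq> j" "x \<in> pverts (F i)"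
        "y \<in> pverts (F j)" "(i, j) \<in> parcs G"
      have "(j, i) \<in> parcs G" using *(6) by (rule symD[OF pair_graphD(2)[OF G]])
      with * show "(\<exists>i\<in>pverts G. (y, x) \<in> parcs (F i)) \<or> (\<exists>i\<in>pverts G. \<exists>j\<in>pverts G.
          i \<noteq> j \<and> y \<in> pverts (F i) \<and> x \<in> pverts (F j) \<and> (i, j) \<in> parcs G)"
        by (intro disjI2 bexI[of _ j] bexI[of _ i]) auto
    qed
  qed
  moreover have "x \<noteq> y" if "(x, y) \<in> parcs ?H" for x y
    using that disj unfolding arcs by (auto simp: disjoint_family_on_def dest: FD(3))
  ultimately show ?thesis
    using wf fin finite_subset[OF wf]
    by unfold_locales (auto simp: symmetric_def)
qed

lemma induced_subgraph_gen_lex_prod: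
  assumes G: "pair_graph G" and F: "\<And>i. i \<in> pverts G \<Longrightarrow> pair_graph (F i)"
    and disj: "disjoint_family_on (\<lambda>i. pverts (F i)) (pverts G)" and i: "i \<in> pverts G"
  shows "induced_subgraph (with_proj (F i)) (with_proj (gen_lex_prod G F))"
proof -
  have wf: "x \<in> pverts (F j) \<and> y \<in> pverts (F j)"
    if "j \<in> pverts G" "(x, y) \<in> parcs (F j)" for j x y
    using pair_graphD(4,5)[OF F[OF that(1)] that(2)] by simp
  have uniq: "j = k" if "j \<in> pverts G" "k \<in> pverts G" "x \<in> pverts (F j)" "x \<in> pverts (F k)" for j k x
    using disj that by (auto simp: disjoint_family_on_def)
  have arcs: "parcs (F i) = {e \<in> parcs (gen_lex_prod G F). fst e \<in> pverts (F i) \<and> snd e \<in> pverts (F i)}"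
    (is "?L = ?R")
  proof
    show "?L \<subseteq> ?R"
      using wf[OF i] i by (auto simp: gen_lex_prod_def)
    show "?R \<subseteq> ?L"
    proof (rule subrelI)
      fix x y assume "(x, y) \<in> ?R"
      then have xy: "x \<in> pverts (F i)" "y \<in> pverts (F i)" "(x, y) \<in> parcs (gen_lex_prod G F)"
        by auto
      from xy(3) consider j where "j \<in> pverts G" "(x, y) \<in> parcs (F j)"
        | j k where "j \<in> pverts G" "k \<in> pverts G" "j \<noteq> k" "x \<in> pverts (F j)" "y \<in> pverts (F k)"
        unfolding gen_lex_prod_def by auto
      then show "(x, y) \<in> ?L"
      proof cases
        case (1 j)
        then have "j = i" using wf[of j x y] uniq[of j i x] i xy(1) by blast
        with 1 show ?thesis by simp
      next
        case (2 j k)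
        then show ?thesis using uniq[of j i x] uniq[of k i y] i xy by blast
      qed
    qed
  qed
  interpret H: pair_graph "gen_lex_prod G F"
    using G F disj by (rule pair_graph_gen_lex_prod)
  interpret Fi: pair_graph "F i" by (rule F[OF i])
  have verts: "pverts (F i) \<subseteq> pverts (gen_lex_prod G F)"
    using i by (auto simp: gen_lex_prod_def)
  have sub: "parcs (F i) \<subseteq> parcs (gen_lex_prod G F)"
    using i by (auto simp: gen_lex_prod_def)
  show ?thesis
    unfolding induced_subgraph_def subgraph_def compatible_def with_proj_simps
    by (intro conjI verts sub arcs refl Fi.wf_digraph H.wf_digraph)
qed

end

theory Submission
  imports Defs
begin

text \<open>An independent set \<open>S\<close> of \<open>G[\<Phi>]\<close> meets exactly the fibres \<open>F\<^sub>i\<close> over an independent set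
  \<open>I\<close> of \<open>G\<close>, each of them in an independent set of \<open>F\<^sub>i\<close>, and every such choice occurs. If
  all fibres are nonempty, then \<open>S\<close> is maximal iff \<open>I\<close> and all its traces on the \<open>F\<^sub>i\<close> with
  \<open>i \<in> I\<close> are. As \<open>card S\<close> is the sum of the cardinalities of the traces, optimising
  over the traces and then over \<open>I\<close> gives both formulas.\<close>

section \<open>Independent and maximal independent sets of a single finite graph\<close>

lemma finite_independent_sets:
  assumes "finite (pverts H)"
  shows "finite {S. independent_set H S}"
  by (rule finite_subset[of _ "Pow (pverts H)"]) (auto simp: independent_set_def assms)

lemma finite_maximal_independent_sets:
  assumes "finite (pverts H)"
  shows "finite {S. maximal_independent_set H S}"
  by (rule finite_subset[OF _ finite_independent_sets[OF assms]])
    (auto simp: maximal_independent_set_def)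

lemma independent_set_empty: "independent_set H {}"
  by (simp add: independent_set_def)

text \<open>The finite family of independent sets contains the empty set, so it has an
  inclusion-maximal member. Hence the \<open>Min\<close> defining
  \<open>independent_domination_number\<close> ranges over a nonempty set and is attained.\<close>

lemma maximal_independent_set_exists:
  assumes "finite (pverts H)"
  shows "\<exists>S. maximal_independent_set H S"
  using finite_has_maximal[OF finite_independent_sets[OF assms]] independent_set_empty[of H]
  unfolding maximal_independent_set_def by blast

lemma independence_number_attained:
  assumes "finite (pverts H)"
  obtains S where "independent_set H S" "card S = independence_number H"
proof -
  have "independence_number H \<in> card ` {S. independent_set H S}"
    unfolding independence_number_def
    by (rule Max_in) (use finite_independent_sets[OF assms] independent_set_empty in auto)
  with that show thesis by auto
qed

lemma card_le_independence_number:
  assumes "finite (pverts H)" "independent_set H S"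
  shows "card S \<le> independence_number H"
  unfolding independence_number_def
  by (rule Max_ge) (use finite_independent_sets assms in auto)

lemma independent_domination_number_attained:
  assumes "finite (pverts H)"
  obtains S where "maximal_independent_set H S" "card S = independent_domination_number H"
proof -
  have "independent_domination_number H \<in> card ` {S. maximal_independent_set H S}"
    unfolding independent_domination_number_def
    by (rule Min_in)
      (use finite_maximal_independent_sets[OF assms] maximal_independent_set_exists[OF assms] in auto)
  with that show thesis by auto
qed

lemma independent_domination_number_le_card:
  assumes "finite (pverts H)" "maximal_independent_set H S"
  shows "independent_domination_number H \<le> card S"
  unfolding independent_domination_number_def
  by (rule Min_le) (use finite_maximal_independent_sets assms in auto)

text \<open>A vertex outside an independent set can be added to it unless it has a neighbour there.
  This replaces the quantification over all supersets by a condition on single vertices, which can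
  be checked fibre by fibre in the product.\<close>

lemma maximal_independent_set_iff_dominating:
  assumes "pair_graph H"
  shows "maximal_independent_set H S \<longleftrightarrow>
    independent_set H S \<and> (\<forall>x\<in>pverts H - S. \<exists>y\<in>S. (x, y) \<in> parcs H)"
proof (intro iffI conjI ballI)
  assume "maximal_independent_set H S"
  then show ind: "independent_set H S" by (simp add: maximal_independent_set_def)
  fix x assume x: "x \<in> pverts H - S"
  then have "S \<subset> insert x S" by auto
  with \<open>maximal_independent_set H S\<close> have "\<not> independent_set H (insert x S)"
    unfolding maximal_independent_set_def by blast
  \<comment> \<open>As \<open>S\<close> itself is independent, an arc inside
    \<open>insert x S\<close> must involve \<open>x\<close>. It is no loop, and symmetry lets it
    start at \<open>x\<close>.\<close>
  with ind x show "\<exists>y\<in>S. (x, y) \<in> parcs H"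
    using symD[OF pair_graphD(2)[OF assms]] pair_graphD(3)[OF assms]
    unfolding independent_set_def by blast
next
  assume "independent_set H S \<and> (\<forall>x\<in>pverts H - S. \<exists>y\<in>S. (x, y) \<in> parcs H)"
  then show "maximal_independent_set H S"
    unfolding maximal_independent_set_def independent_set_def by blast
qed

lemma maximal_independent_set_nonempty:
  assumes "pair_graph H" "maximal_independent_set H S" "pverts H \<noteq> {}"
  shows "S \<noteq> {}"
  using assms by (auto simp: maximal_independent_set_iff_dominating)

text \<open>\<open>pair_graph\<close> admits the graph without vertices, and this lemma isolates
  that case: as soon as there is a vertex, the empty set fails to dominate it. In this way the
  common value of the fibres decides whether they are empty.\<close>

lemma independent_domination_number_eq_0_iff:
  assumes "pair_graph H"
  shows "independent_domination_number H = 0 \<longleftrightarrow> pverts H = {}"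
proof -
  note fin = pair_graphD(1)[OF assms]
  obtain S where S: "maximal_independent_set H S" "card S = independent_domination_number H"
    by (rule independent_domination_number_attained[OF fin])
  have "S \<subseteq> pverts H"
    using S(1) by (simp add: maximal_independent_set_def independent_set_def)
  then have "card S = 0 \<longleftrightarrow> S = {}" using fin finite_subset by fastforce
  with S \<open>S \<subseteq> pverts H\<close> maximal_independent_set_nonempty[OF assms] show ?thesis by auto
qed

section \<open>Fibres, traces and supports in the product graph\<close>

locale graph_family =
  fixes G :: "'v pair_pre_digraph" and F :: "'v \<Rightarrow> 'a pair_pre_digraph"
  assumes pair_graph_base: "pair_graph G"
    and pair_graph_fibre: "i \<in> pverts G \<Longrightarrow> pair_graph (F i)"
    and disjoint_fibres: "disjoint_family_on (\<lambda>i. pverts (F i)) (pverts G)"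
begin

abbreviation (input) "H \<equiv> gen_lex_prod G F"

text \<open>The projection of \<open>S\<close> to the base graph, that is, the set \<open>I\<close>
  of the overview.\<close>

definition support :: "'a set \<Rightarrow> 'v set" where
  "support S = {i \<in> pverts G. S \<inter> pverts (F i) \<noteq> {}}"

lemma support_subset: "support S \<subseteq> pverts G"
  by (auto simp: support_def)

lemma finite_base: "finite (pverts G)"
  by (rule pair_graphD(1)[OF pair_graph_base])

lemma finite_fibre: "i \<in> pverts G \<Longrightarrow> finite (pverts (F i))"
  by (rule pair_graphD(1)[OF pair_graph_fibre])

lemma pair_graph_product: "pair_graph H"
  using pair_graph_base pair_graph_fibre disjoint_fibres by (rule pair_graph_gen_lex_prod)

lemma finite_product: "finite (pverts H)"
  by (rule pair_graphD(1)[OF pair_graph_product])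

lemma pverts_product: "pverts H = (\<Union>i\<in>pverts G. pverts (F i))"
  by (simp add: gen_lex_prod_def)

lemma fibre_unique:
  "\<lbrakk>i \<in> pverts G; j \<in> pverts G; x \<in> pverts (F i); x \<in> pverts (F j)\<rbrakk> \<Longrightarrow> i = j"
  using disjoint_fibres by (auto simp: disjoint_family_on_def)

text \<open>By disjointness a vertex determines its fibre, so the index quantifiers in
  \<open>gen_lex_prod_def\<close> collapse to the given \<open>i\<close> and
  \<open>j\<close>.\<close>

lemma arc_product_iff:
  assumes "i \<in> pverts G" "j \<in> pverts G" "x \<in> pverts (F i)" "y \<in> pverts (F j)"
  shows "(x, y) \<in> parcs H \<longleftrightarrow> (if i = j then (x, y) \<in> parcs (F i) else (i, j) \<in> parcs G)"
proof -
  have fibre: "k = i \<and> k = j" if "k \<in> pverts G" "(x, y) \<in> parcs (F k)" for k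
    using that fibre_unique[of k i x] fibre_unique[of k j y] assms
      pair_graphD(4,5)[OF pair_graph_fibre[of k]] by blast
  have base: "k = i \<and> l = j"
    if "k \<in> pverts G" "l \<in> pverts G" "x \<in> pverts (F k)" "y \<in> pverts (F l)" for k l
    using that fibre_unique[of k i x] fibre_unique[of l j y] assms by blast
  have "(x, y) \<in> parcs H \<longleftrightarrow> (\<exists>k\<in>pverts G. (x, y) \<in> parcs (F k)) \<or>
      (\<exists>k\<in>pverts G. \<exists>l\<in>pverts G. k \<noteq> l \<and> x \<in> pverts (F k) \<and> y \<in> pverts (F l) \<and> (k, l) \<in> parcs G)"
    by (simp add: gen_lex_prod_def)
  also have "(\<exists>k\<in>pverts G. (x, y) \<in> parcs (F k)) \<longleftrightarrow> i = j \<and> (x, y) \<in> parcs (F i)"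
    using fibre assms(1) by metis
  also have "(\<exists>k\<in>pverts G. \<exists>l\<in>pverts G. k \<noteq> l \<and> x \<in> pverts (F k) \<and> y \<in> pverts (F l) \<and> (k, l) \<in> parcs G)
      \<longleftrightarrow> i \<noteq> j \<and> (i, j) \<in> parcs G"
    using base assms by metis
  finally show ?thesis by simp
qed

lemma independent_set_trace:
  assumes "independent_set H S" "i \<in> pverts G"
  shows "independent_set (F i) (S \<inter> pverts (F i))"
  using assms by (auto simp: independent_set_def gen_lex_prod_def)

text \<open>Fibres over adjacent indices are completely joined, so two adjacent indices in the
  support would yield two adjacent elements of \<open>S\<close>.\<close>

lemma independent_set_support:
  assumes "independent_set H S"
  shows "independent_set G (support S)"
  unfolding independent_set_def
proof (intro conjI ballI support_subset notI)
  fix i j assume ij: "i \<in> support S" "j \<in> support S" and arc: "(i, j) \<in> parcs G"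
  from ij obtain x y where *: "i \<in> pverts G" "j \<in> pverts G" "x \<in> S" "y \<in> S"
      "x \<in> pverts (F i)" "y \<in> pverts (F j)"
    by (auto simp: support_def)
  have "i \<noteq> j" using arc by (rule pair_graphD(3)[OF pair_graph_base])
  then have "(x, y) \<in> parcs H" using arc * arc_product_iff[of i j x y] by simp
  with assms * show False by (auto simp: independent_set_def)
qed

text \<open>Subsets of different fibres are disjoint. This serves both to split a given set into its
  traces and to count a set assembled from chosen pieces.\<close>

lemma card_UN_fibres:
  assumes "I \<subseteq> pverts G" "\<And>i. i \<in> I \<Longrightarrow> T i \<subseteq> pverts (F i)"
  shows "card (\<Union>i\<in>I. T i) = (\<Sum>i\<in>I. card (T i))"
proof (rule card_UN_disjoint)
  show "finite I" using assms(1) finite_base by (rule finite_subset)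
  show "\<forall>i\<in>I. finite (T i)" using assms finite_fibre by (meson finite_subset subsetD)
  show "\<forall>i\<in>I. \<forall>j\<in>I. i \<noteq> j \<longrightarrow> T i \<inter> T j = {}"
  proof (intro ballI impI equals0I)
    fix i j x assume "i \<in> I" "j \<in> I" "i \<noteq> j" "x \<in> T i \<inter> T j"
    with assms(2)[of i] assms(2)[of j] have "x \<in> pverts (F i)" "x \<in> pverts (F j)" by auto
    with fibre_unique[of i j x] \<open>i \<in> I\<close> \<open>j \<in> I\<close> \<open>i \<noteq> j\<close> assms(1) show False by auto
  qed
qed

lemma card_eq_sum_traces:
  assumes "S \<subseteq> pverts H"
  shows "card S = (\<Sum>i\<in>support S. card (S \<inter> pverts (F i)))"
proof -
  have "S = (\<Union>i\<in>support S. S \<inter> pverts (F i))"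
    using assms unfolding support_def pverts_product by blast
  also have "card \<dots> = (\<Sum>i\<in>support S. card (S \<inter> pverts (F i)))"
    by (rule card_UN_fibres[OF support_subset]) blast
  finally show ?thesis .
qed

text \<open>Two chosen vertices lie either in one fibre, where \<open>T i\<close> is independent, or
  in fibres over distinct, non-adjacent indices of \<open>I\<close>.\<close>

lemma independent_set_UN:
  assumes "independent_set G I" "\<And>i. i \<in> I \<Longrightarrow> independent_set (F i) (T i)"
  shows "independent_set H (\<Union>i\<in>I. T i)"
  unfolding independent_set_def
proof (intro conjI ballI)
  show "(\<Union>i\<in>I. T i) \<subseteq> pverts H"
    using assms unfolding independent_set_def pverts_product by blast
next
  fix x y assume "x \<in> (\<Union>i\<in>I. T i)" "y \<in> (\<Union>i\<in>I. T i)"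
  then obtain i j where ij: "i \<in> I" "x \<in> T i" "j \<in> I" "y \<in> T j" by blast
  then have "i \<in> pverts G" "j \<in> pverts G" "x \<in> pverts (F i)" "y \<in> pverts (F j)"
    using assms by (auto simp: independent_set_def)
  with ij assms show "(x, y) \<notin> parcs H"
    by (auto simp: arc_product_iff independent_set_def)
qed

section \<open>The independence number of the product\<close>

lemma independence_number_product:
  assumes eq: "\<And>i. i \<in> pverts G \<Longrightarrow> independence_number (F i) = b"
  shows "independence_number H = independence_number G * b"
proof (rule antisym)
  obtain S where S: "independent_set H S" "card S = independence_number H"
    by (rule independence_number_attained[OF finite_product])
  have "card S = (\<Sum>i\<in>support S. card (S \<inter> pverts (F i)))"
    using S(1) by (intro card_eq_sum_traces) (simp add: independent_set_def)
  also have "\<dots> \<le> (\<Sum>i\<in>support S. b)"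
  proof (rule sum_mono)
    fix i assume "i \<in> support S"
    then have "i \<in> pverts G" using support_subset by blast
    then show "card (S \<inter> pverts (F i)) \<le> b"
      using card_le_independence_number[OF finite_fibre independent_set_trace[OF S(1)], of i] eq
      by simp
  qed
  also have "\<dots> = card (support S) * b" by simp
  also have "\<dots> \<le> independence_number G * b"
    by (intro mult_le_mono1 card_le_independence_number finite_base independent_set_support S(1))
  finally show "independence_number H \<le> independence_number G * b" using S(2) by simp
next
  obtain I where I: "independent_set G I" "card I = independence_number G"
    by (rule independence_number_attained[OF finite_base])
  have IG: "I \<subseteq> pverts G" using I(1) by (simp add: independent_set_def)
  \<comment> \<open>For the lower bound, a largest independent set is taken in every fibre over a
    largest independent set \<open>I\<close> of the base.\<close>
  have "\<forall>i\<in>I. \<exists>T. independent_set (F i) T \<and> card T = b"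
    using IG eq independence_number_attained[OF finite_fibre] by (metis subsetD)
  then obtain T where T: "\<And>i. i \<in> I \<Longrightarrow> independent_set (F i) (T i) \<and> card (T i) = b"
    by metis
  have "independence_number G * b = (\<Sum>i\<in>I. card (T i))" using I(2) T by simp
  also have "\<dots> = card (\<Union>i\<in>I. T i)"
    by (rule card_UN_fibres[symmetric, OF IG]) (use T in \<open>auto simp: independent_set_def\<close>)
  also have "\<dots> \<le> independence_number H"
    by (intro card_le_independence_number finite_product independent_set_UN I(1)) (use T in auto)
  finally show "independence_number G * b \<le> independence_number H" .
qed

section \<open>Maximal independent sets of the product\<close>

lemma maximal_independent_set_support:
  assumes S: "maximal_independent_set H S"
    and ne: "\<And>i. i \<in> pverts G \<Longrightarrow> pverts (F i) \<noteq> {}"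
  shows "maximal_independent_set G (support S)"
  unfolding maximal_independent_set_iff_dominating[OF pair_graph_base]
proof (intro conjI ballI)
  have S': "independent_set H S" "\<forall>x\<in>pverts H - S. \<exists>y\<in>S. (x, y) \<in> parcs H"
    using S unfolding maximal_independent_set_iff_dominating[OF pair_graph_product] by auto
  show "independent_set G (support S)" by (rule independent_set_support[OF S'(1)])
  fix i assume i: "i \<in> pverts G - support S"
  \<comment> \<open>Nonemptiness of the fibre enters here: \<open>x\<close> represents
    \<open>i\<close> in the product. It lies outside \<open>S\<close>, so it has a neighbour in
    \<open>S\<close>; the index of that neighbour lies in the support and dominates
    \<open>i\<close>.\<close>
  then obtain x where x: "x \<in> pverts (F i)" using ne by blast
  with i have "x \<in> pverts H - S" by (auto simp: support_def pverts_product)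
  then obtain y where y: "y \<in> S" "(x, y) \<in> parcs H" using S'(2) by blast
  then obtain j where j: "j \<in> pverts G" "y \<in> pverts (F j)"
    using S'(1) by (auto simp: independent_set_def pverts_product)
  with y(1) have "j \<in> support S" by (auto simp: support_def)
  with i have "i \<noteq> j" by auto
  then have "(i, j) \<in> parcs G" using y(2) x i j arc_product_iff[of i j x y] by simp
  with \<open>j \<in> support S\<close> show "\<exists>j\<in>support S. (i, j) \<in> parcs G" by blast
qed

text \<open>A vertex of \<open>F i\<close> outside \<open>S\<close> has a neighbour in
  \<open>S\<close>, over some \<open>j\<close> in the support. Since the support is independent and
  contains both indices, the arc cannot come from the base, so \<open>i = j\<close> and the
  neighbour belongs to the trace.\<close>

lemma maximal_independent_set_trace:
  assumes S: "maximal_independent_set H S" and i: "i \<in> support S"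
  shows "maximal_independent_set (F i) (S \<inter> pverts (F i))"
proof -
  have iG: "i \<in> pverts G" using i support_subset by blast
  have S': "independent_set H S" "\<forall>x\<in>pverts H - S. \<exists>y\<in>S. (x, y) \<in> parcs H"
    using S unfolding maximal_independent_set_iff_dominating[OF pair_graph_product] by auto
  have "\<exists>y\<in>S \<inter> pverts (F i). (x, y) \<in> parcs (F i)" if x: "x \<in> pverts (F i) - S" for x
  proof -
    have "x \<in> pverts H - S" using x iG by (auto simp: pverts_product)
    then obtain y where y: "y \<in> S" "(x, y) \<in> parcs H" using S'(2) by blast
    then obtain j where j: "j \<in> pverts G" "y \<in> pverts (F j)"
      using S'(1) by (auto simp: independent_set_def pverts_product)
    have "j \<in> support S" using y(1) j by (auto simp: support_def)
    then have "(i, j) \<notin> parcs G"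
      using i independent_set_support[OF S'(1)] by (simp add: independent_set_def)
    then have "i = j" "(x, y) \<in> parcs (F i)"
      using y(2) x iG j arc_product_iff[of i j x y] by (auto split: if_splits)
    with y(1) j show ?thesis by blast
  qed
  then show ?thesis
    using independent_set_trace[OF S'(1) iG]
    by (auto simp: maximal_independent_set_iff_dominating[OF pair_graph_fibre[OF iG]])
qed

text \<open>A vertex over an index in \<open>I\<close> is dominated within its own fibre. A vertex
  over any other index is adjacent to all of \<open>T j\<close> for some neighbour \<open>j\<close>
  in \<open>I\<close>, and \<open>T j\<close> being nonempty provides a dominating vertex.\<close>

lemma maximal_independent_set_UN:
  assumes I: "maximal_independent_set G I"
    and T: "\<And>i. i \<in> I \<Longrightarrow> maximal_independent_set (F i) (T i)"
    and ne: "\<And>i. i \<in> I \<Longrightarrow> T i \<noteq> {}"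
  shows "maximal_independent_set H (\<Union>i\<in>I. T i)"
  unfolding maximal_independent_set_iff_dominating[OF pair_graph_product]
proof (intro conjI ballI)
  have I': "independent_set G I" "\<forall>i\<in>pverts G - I. \<exists>j\<in>I. (i, j) \<in> parcs G"
    using I unfolding maximal_independent_set_iff_dominating[OF pair_graph_base] by auto
  have IG: "I \<subseteq> pverts G" using I'(1) by (simp add: independent_set_def)
  have T': "independent_set (F i) (T i)" "\<forall>x\<in>pverts (F i) - T i. \<exists>y\<in>T i. (x, y) \<in> parcs (F i)"
    if "i \<in> I" for i
    using T[OF that] IG that
    by (auto simp: maximal_independent_set_iff_dominating[OF pair_graph_fibre])
  have TF: "T i \<subseteq> pverts (F i)" if "i \<in> I" for i
    using T'(1)[OF that] by (simp add: independent_set_def)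
  show "independent_set H (\<Union>i\<in>I. T i)"
    using I'(1) T'(1) by (rule independent_set_UN)
  fix x assume x: "x \<in> pverts H - (\<Union>i\<in>I. T i)"
  then obtain i where i: "i \<in> pverts G" "x \<in> pverts (F i)" by (auto simp: pverts_product)
  show "\<exists>y\<in>\<Union>i\<in>I. T i. (x, y) \<in> parcs H"
  proof (cases "i \<in> I")
    case True
    with x i obtain y where "y \<in> T i" "(x, y) \<in> parcs (F i)" using T'(2) by blast
    with True i TF show ?thesis using arc_product_iff[of i i x y] by auto
  next
    case False
    with i obtain j where j: "j \<in> I" "(i, j) \<in> parcs G" using I'(2) by blast
    then obtain y where y: "y \<in> T j" using ne by blast
    have "j \<in> pverts G" "y \<in> pverts (F j)" "i \<noteq> j" using j y False TF IG by auto
    with i j have "(x, y) \<in> parcs H" by (simp add: arc_product_iff)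
    with j y show ?thesis by blast
  qed
qed

section \<open>The independent domination number of the product\<close>

lemma independent_domination_number_product:
  assumes eq: "\<And>i. i \<in> pverts G \<Longrightarrow> independent_domination_number (F i) = b"
  shows "independent_domination_number H = independent_domination_number G * b"
\<comment> \<open>If \<open>b = 0\<close>, all fibres and hence the product have no vertices, and
  both sides vanish. Otherwise all fibres are nonempty, as required for the support of a maximal
  independent set to be maximal.\<close>
proof (cases "b = 0")
  case True
  then have "pverts H = {}"
    using eq by (simp add: pverts_product
        independent_domination_number_eq_0_iff[OF pair_graph_fibre, symmetric])
  then show ?thesis
    using True independent_domination_number_eq_0_iff[OF pair_graph_product] by simp
next
  case False
  then have ne: "pverts (F i) \<noteq> {}" if "i \<in> pverts G" for i
    using that eq independent_domination_number_eq_0_iff[OF pair_graph_fibre] by metis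
  show ?thesis
  proof (rule antisym)
    obtain I where I: "maximal_independent_set G I" "card I = independent_domination_number G"
      by (rule independent_domination_number_attained[OF finite_base])
    have IG: "I \<subseteq> pverts G"
      using I(1) by (simp add: maximal_independent_set_def independent_set_def)
    have "\<forall>i\<in>I. \<exists>T. maximal_independent_set (F i) T \<and> card T = b"
      using IG eq independent_domination_number_attained[OF finite_fibre] by (metis subsetD)
    then obtain T where T: "\<And>i. i \<in> I \<Longrightarrow> maximal_independent_set (F i) (T i) \<and> card (T i) = b"
      by metis
    \<comment> \<open>The pieces \<open>T i\<close> have \<open>b > 0\<close> elements, so they are
      nonempty and their union is again maximal.\<close>
    have "independent_domination_number H \<le> card (\<Union>i\<in>I. T i)"
      by (intro independent_domination_number_le_card finite_product maximal_independent_set_UN I(1))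
        (use T False in force)+
    also have "\<dots> = (\<Sum>i\<in>I. card (T i))"
      using T by (intro card_UN_fibres IG)
        (auto simp: maximal_independent_set_def independent_set_def)
    also have "\<dots> = independent_domination_number G * b" using I(2) T by simp
    finally show "independent_domination_number H \<le> independent_domination_number G * b" .
  next
    obtain S where S: "maximal_independent_set H S" "card S = independent_domination_number H"
      by (rule independent_domination_number_attained[OF finite_product])
    \<comment> \<open>For the lower bound, the support of a smallest maximal \<open>S\<close> is
      maximal in the base, and each trace over it is maximal in its fibre, hence has at least
      \<open>b\<close> elements.\<close>
    have "independent_domination_number G * b \<le> card (support S) * b"
      by (intro mult_le_mono1 independent_domination_number_le_card finite_base
          maximal_independent_set_support S(1) ne)
    also have "\<dots> = (\<Sum>i\<in>support S. b)" by simp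
    also have "\<dots> \<le> (\<Sum>i\<in>support S. card (S \<inter> pverts (F i)))"
    proof (rule sum_mono)
      fix i assume i: "i \<in> support S"
      then have "i \<in> pverts G" using support_subset by blast
      then show "b \<le> card (S \<inter> pverts (F i))"
        using independent_domination_number_le_card[OF finite_fibre
            maximal_independent_set_trace[OF S(1) i]] eq by simp
    qed
    also have "\<dots> = card S"
      using S(1) by (intro card_eq_sum_traces[symmetric])
        (simp add: maximal_independent_set_def independent_set_def)
    finally show "independent_domination_number G * b \<le> independent_domination_number H"
      using S(2) by simp
  qed
qed

end

theorem theorem3p5:
  fixes G :: "nat pair_pre_digraph" and F :: "nat \<Rightarrow> 'a pair_pre_digraph" and n :: nat
  assumes "pair_graph G"
    and "pverts G = {1..n}"
    and "n \<ge> 2"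
    and "Digraph_Component.connected (with_proj G)"
    and "\<forall>i\<in>{1..n}. pair_graph (F i)"
    and "disjoint_family_on (\<lambda>i. pverts (F i)) {1..n}"
  shows "((\<forall>i\<in>{1..n}. independent_domination_number (F i) = independent_domination_number (F 1))
      \<longrightarrow> independent_domination_number (gen_lex_prod G F)
          = independent_domination_number G * independent_domination_number (F 1))
    \<and> ((\<forall>i\<in>{1..n}. independence_number (F i) = independence_number (F 1))
      \<longrightarrow> independence_number (gen_lex_prod G F)
          = independence_number G * independence_number (F 1))"
proof -
  interpret graph_family G F
    by (rule graph_family.intro) (use assms in simp_all)
  \<comment> \<open>The common value \<open>b\<close> is instantiated with the respective value at
    \<open>F 1\<close>.\<close>
  show ?thesis
    using independent_domination_number_product[of "independent_domination_number (F 1)"]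
      independence_number_product[of "independence_number (F 1)"]
    unfolding assms(2) by blast
qed

end
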